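(* Let $\omega$ be a weight. The following statements are equivalent. (1) ($\omega\in A_\infty^{exp}$) There exists a positive constant $C$ such that for all $n\in\mathbb{N}$, $\mathbb{E}(\omega|\mathcal{F}_n)\le C\exp\mathbb{E}(\log\omega|\mathcal{F}_n)$. (2) ($\omega\in A_\infty^{SW}$) There exists $C>1$ such that for every $s\in(0,1)$ and all $n\in\mathbb{N}$, $\mathbb{E}(\omega|\mathcal{F}_n)\le C\,\mathbb{E}(\omega^s|\mathcal{F}_n)^{\frac1s}$.
   Context: $(\Omega,\mathcal{F},\mu)$ is a complete probability space and $(\mathcal{F}_n)_{n\ge0}$ is an increasing sequence of sub-$\sigma$-fields of $\mathcal{F}$ with $\mathcal{F}=\bigvee_{n\ge0}\mathcal{F}_n$. $\mathbb{N}$ is the set of non-negative integers. $\mathbb{E}(\cdot|\mathcal{F}_n)$ is conditional expectation with respect to $\mu$. Relations between random variables hold almost surely. A weight $\omega$ is a random variable with $\omega>0$ and $\mathbb{E}(\omega)<\infty$. The conditional expectation $\mathbb{E}(\log\omega|\mathcal{F}_n)$ takes values in $[-\infty,\infty)$, with $\exp(-\infty)=0$. *)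

theory Defs
  imports "HOL-Probability.Probability"
begin

definition weight :: "'a measure \<Rightarrow> ('a \<Rightarrow> real) \<Rightarrow> bool" where
  "weight M w \<longleftrightarrow> w \<in> borel_measurable M \<and> (AE x in M. 0 < w x) \<and> integrable M w"

(* Extended-real analogue of real_cond_exp, which would return a junk value where the conditional
   expectation of the negative part is infinite. Since ennreal truncates negative reals to 0, this
   is E(f^+ | F) - E(f^- | F), meaningful whenever f^+ is integrable; then E(f^+ | F) is finite
   almost everywhere and the value lies in [-\<infinity>, \<infinity>). For f = ln w with w a weight this applies,
   as ln w \<le> w. *)
definition ereal_cond_exp :: "'a measure \<Rightarrow> 'a measure \<Rightarrow> ('a \<Rightarrow> real) \<Rightarrow> 'a \<Rightarrow> ereal" where
  "ereal_cond_exp M F f x =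
     enn2ereal (nn_cond_exp M F (\<lambda>y. ennreal (f y)) x)
     - enn2ereal (nn_cond_exp M F (\<lambda>y. ennreal (- f y)) x)"

definition exp_ereal :: "ereal \<Rightarrow> ereal" where
  "exp_ereal x =
     (if x = -\<infinity> then 0 else if x = \<infinity> then \<infinity> else ereal (exp (real_of_ereal x)))"

definition A_inf_exp :: "'a measure \<Rightarrow> (nat \<Rightarrow> 'a measure) \<Rightarrow> ('a \<Rightarrow> real) \<Rightarrow> bool" where
  "A_inf_exp M F w \<longleftrightarrow>
     (\<exists>C::real. C > 0 \<and> (\<forall>n. AE x in M.
        ereal (real_cond_exp M (F n) w x)
          \<le> ereal C * exp_ereal (ereal_cond_exp M (F n) (\<lambda>y. ln (w y)) x)))"

definition A_inf_SW :: "'a measure \<Rightarrow> (nat \<Rightarrow> 'a measure) \<Rightarrow> ('a \<Rightarrow> real) \<Rightarrow> bool" where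
  "A_inf_SW M F w \<longleftrightarrow>
     (\<exists>C::real. C > 1 \<and> (\<forall>s. 0 < s \<and> s < 1 \<longrightarrow> (\<forall>n. AE x in M.
        real_cond_exp M (F n) w x
          \<le> C * real_cond_exp M (F n) (\<lambda>y. w y powr s) x powr (1 / s))))"

end

theory Submission
  imports Defs
begin

text \<open>
  Write \<open>w = exp l\<close>. The equivalence compares the conditional geometric mean \<open>exp E(l | F)\<close> with
  the conditional power means \<open>E(exp (s l) | F) powr (1/s)\<close>: the geometric mean lies below every
  power mean, and it is their limit as \<open>s\<close> tends to \<open>0\<close>. The first fact turns the exponential
  condition into the power-mean condition; the second one gives the converse, because the constant
  does not depend on \<open>s\<close>. Both facts concern a single sub-sigma-algebra.

  The first fact (\<open>exp_cond_exp_le\<close>) is a conditional Jensen inequality for a function \<open>l\<close> whose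
  negative part may have infinite conditional expectation. The tangent lines of \<open>ln\<close> give
  \<open>s l \<le> ln q - 1 + exp (s l) / q\<close> for all \<open>q > 0\<close>. Taking conditional expectations for
  every rational \<open>q\<close> outside one common null set and then letting \<open>q\<close> tend to \<open>E(exp (s l) | F)\<close>
  pointwise yields \<open>s E(l | F) \<le> ln E(exp (s l) | F)\<close>.

  For the second fact (\<open>le_exp_cond_exp\<close>), \<open>ln y \<le> y - 1\<close> bounds the logarithm of the
  power mean by the conditional expectation of \<open>(exp (s l) - 1) / s\<close>. Along \<open>s = 1/2^i\<close>
  these quotients decrease to \<open>l\<close>, so their conditional expectations converge to \<open>E(l | F)\<close> by
  monotone convergence (\<open>real_cond_exp_tendsto_ereal_cond_exp\<close>).

  Infinite values are handled by subtracting from an integrable majorant: if \<open>f \<le> g\<close> with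
  \<open>g\<close> integrable, then \<open>E(f | F) = E(g | F) - E(g - f | F)\<close>, where the last conditional
  expectation is that of a nonnegative function (\<open>ereal_cond_exp_eq_diff\<close>).
\<close>

section \<open>Conditional expectations with values in the extended reals\<close>

lemma exp_ereal_mono:
  assumes "a \<le> b"
  shows "exp_ereal a \<le> exp_ereal b"
  using assms by (cases a; cases b) (auto simp: exp_ereal_def)

context sigma_finite_subalgebra
begin

text \<open>Conditional monotone convergence: by the ordinary theorem, both sides have the same integral over
  every set of \<open>F\<close>, and this determines the conditional expectation.\<close>

lemma nn_cond_exp_SUP:
  assumes meas [measurable]: "\<And>i. f i \<in> borel_measurable M" and inc: "incseq f"
  shows "AE x in M. (SUP i. nn_cond_exp M F (f i) x) = nn_cond_exp M F (\<lambda>x. SUP i. f i x) x"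
proof (rule nn_cond_exp_charact)
  have mono: "AE x in M. nn_cond_exp M F (f i) x \<le> nn_cond_exp M F (f (Suc i)) x" for i
    using inc by (intro nn_cond_exp_mono) (auto simp: incseq_Suc_iff le_fun_def)
  fix A assume A: "A \<in> sets F"
  then have [measurable]: "A \<in> sets M" using subalg by (auto simp: subalgebra_def)
  have [measurable]: "indicator A \<in> borel_measurable F" using A by simp
  have "(\<integral>\<^sup>+x\<in>A. (SUP i. f i x) \<partial>M) = (\<integral>\<^sup>+x. (SUP i. f i x * indicator A x) \<partial>M)"
    by (simp add: SUP_mult_right_ennreal)
  also have "\<dots> = (SUP i. \<integral>\<^sup>+x. f i x * indicator A x \<partial>M)"
    using inc by (intro nn_integral_monotone_convergence_SUP)
      (auto simp: incseq_def le_fun_def intro!: mult_right_mono)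
  also have "\<dots> = (SUP i. \<integral>\<^sup>+x. nn_cond_exp M F (f i) x * indicator A x \<partial>M)"
    using nn_cond_exp_intg[of "indicator A" "f _"] by (simp add: mult.commute)
  also have "\<dots> = (\<integral>\<^sup>+x. (SUP i. nn_cond_exp M F (f i) x * indicator A x) \<partial>M)"
  proof (rule nn_integral_monotone_convergence_SUP_AE[symmetric])
    show "AE x in M. nn_cond_exp M F (f i) x * indicator A x
        \<le> nn_cond_exp M F (f (Suc i)) x * indicator A x" for i
      using mono[of i] by eventually_elim (intro mult_right_mono, auto)
  qed measurable
  also have "\<dots> = (\<integral>\<^sup>+x\<in>A. (SUP i. nn_cond_exp M F (f i) x) \<partial>M)"
    by (simp add: SUP_mult_right_ennreal)
  finally show "(\<integral>\<^sup>+x\<in>A. (SUP i. f i x) \<partial>M)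
      = (\<integral>\<^sup>+x\<in>A. (SUP i. nn_cond_exp M F (f i) x) \<partial>M)" .
qed measurable

lemma nn_cond_exp_finite:
  assumes [measurable]: "f \<in> borel_measurable M" and fin: "(\<integral>\<^sup>+x. f x \<partial>M) \<noteq> \<infinity>"
  shows "AE x in M. nn_cond_exp M F f x \<noteq> \<infinity>"
proof (rule nn_integral_PInf_AE)
  show "(\<integral>\<^sup>+x. nn_cond_exp M F f x \<partial>M) \<noteq> \<infinity>"
    using nn_cond_exp_intg[of "\<lambda>_. 1" f] fin by simp
qed simp

text \<open>The identity \<open>g\<^sup>+ + f\<^sup>- = g\<^sup>- + (f\<^sup>+ + (g - f))\<close> involves only nonnegative functions, so
  \<open>nn_cond_exp\<close> may be applied termwise. Of the five resulting terms only those of \<open>f\<^sup>-\<close> and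
  \<open>g - f\<close> can be infinite, and they are infinite at the same points. The lemma reduces the
  properties of \<open>ereal_cond_exp\<close> for functions with an integrable majorant to those of
  \<open>nn_cond_exp\<close>.\<close>

lemma ereal_cond_exp_eq_diff:
  assumes f [measurable]: "f \<in> borel_measurable M" and g: "integrable M g"
    and le: "AE x in M. f x \<le> g x"
  shows "AE x in M. ereal_cond_exp M F f x
    = ereal (real_cond_exp M F g x) - enn2ereal (nn_cond_exp M F (\<lambda>y. ennreal (g y - f y)) x)"
proof -
  have [measurable]: "g \<in> borel_measurable M" using g by auto
  let ?E = "\<lambda>h. nn_cond_exp M F (\<lambda>y. ennreal (h y))"
  have bal: "AE x in M. nn_cond_exp M F (\<lambda>y. ennreal (g y) + ennreal (- f y)) x
      = nn_cond_exp M F (\<lambda>y. ennreal (- g y) + (ennreal (f y) + ennreal (g y - f y))) x"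
  proof (rule nn_cond_exp_cong)
    have *: "ennreal v + ennreal (- u) = ennreal (- v) + (ennreal u + ennreal (v - u))"
      if "u \<le> v" for u v :: real
      using that by (cases "0 \<le> u"; cases "0 \<le> v")
        (auto simp: ennreal_neg simp flip: ennreal_plus)
    show "AE x in M. ennreal (g x) + ennreal (- f x)
        = ennreal (- g x) + (ennreal (f x) + ennreal (g x - f x))"
      using le by eventually_elim (rule *)
  qed auto
  have s1: "AE x in M. ?E g x + ?E (\<lambda>y. - f y) x
      = nn_cond_exp M F (\<lambda>y. ennreal (g y) + ennreal (- f y)) x"
    by (rule nn_cond_exp_sum) auto
  have s2: "AE x in M. ?E (\<lambda>y. - g y) x + nn_cond_exp M F (\<lambda>y. ennreal (f y) + ennreal (g y - f y)) x
      = nn_cond_exp M F (\<lambda>y. ennreal (- g y) + (ennreal (f y) + ennreal (g y - f y))) x"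
    by (rule nn_cond_exp_sum) auto
  have s3: "AE x in M. ?E f x + ?E (\<lambda>y. g y - f y) x
      = nn_cond_exp M F (\<lambda>y. ennreal (f y) + ennreal (g y - f y)) x"
    by (rule nn_cond_exp_sum) auto
  have m: "AE x in M. ?E f x \<le> ?E g x"
    using le by (intro nn_cond_exp_mono) (auto simp: ennreal_leI)
  have fin1: "AE x in M. ?E g x \<noteq> \<infinity>"
    using g by (intro nn_cond_exp_finite) (auto simp: real_integrable_def)
  have fin2: "AE x in M. ?E (\<lambda>y. - g y) x \<noteq> \<infinity>"
    using g by (intro nn_cond_exp_finite) (auto simp: real_integrable_def)
  have alg: "enn2ereal d - enn2ereal b = ereal (enn2real a - enn2real c) - enn2ereal e"
    if bal: "a + b = c + (d + e)" and d_le: "d \<le> a" and a_fin: "a \<noteq> \<infinity>" and c_fin: "c \<noteq> \<infinity>"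
    for a b c d e :: ennreal
  proof -
    have "d \<noteq> top" using d_le a_fin by (auto simp: top_unique)
    then obtain d' where d: "d = ennreal d'" "0 \<le> d'" by (cases d) auto
    obtain a' where a: "a = ennreal a'" "0 \<le> a'" using a_fin by (cases a) auto
    obtain c' where c: "c = ennreal c'" "0 \<le> c'" using c_fin by (cases c) auto
    note fin = a c d
    show ?thesis
    proof (cases b)
      case (real b')
      then have "e \<noteq> top" using bal fin by (auto simp flip: ennreal_plus)
      then obtain e' where e: "e = ennreal e'" "0 \<le> e'" by (cases e) auto
      have "a' + b' = c' + (d' + e')"
        using bal fin real e by (simp flip: ennreal_plus)
      then show ?thesis using fin real e by simp
    next
      case top
      then have "e = top" using bal fin by (cases e) (auto simp flip: ennreal_plus)
      then show ?thesis using top fin by simp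
    qed
  qed
  show ?thesis
    using bal s1 s2 s3 m fin1 fin2
  proof eventually_elim
    case (elim x)
    then show ?case
      unfolding ereal_cond_exp_def real_cond_exp_def by (intro alg) auto
  qed
qed

lemma ereal_cond_exp_le_real_cond_exp:
  assumes "f \<in> borel_measurable M" "integrable M g" "AE x in M. f x \<le> g x"
  shows "AE x in M. ereal_cond_exp M F f x \<le> ereal (real_cond_exp M F g x)"
  using ereal_cond_exp_eq_diff[OF assms]
  by eventually_elim (simp add: ereal_diff_le_self)

lemma ereal_cond_exp_eq_real_cond_exp:
  assumes f: "integrable M f"
  shows "AE x in M. ereal_cond_exp M F f x = ereal (real_cond_exp M F f x)"
proof -
  have "AE x in M. 0 = nn_cond_exp M F (\<lambda>y. ennreal (f y - f y)) x"
    using nn_cond_exp_F_meas[of "\<lambda>_. 0"] by simp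
  moreover have "AE x in M. ereal_cond_exp M F f x
    = ereal (real_cond_exp M F f x) - enn2ereal (nn_cond_exp M F (\<lambda>y. ennreal (f y - f y)) x)"
    using f by (intro ereal_cond_exp_eq_diff) auto
  ultimately show ?thesis
  proof eventually_elim
    case (elim x)
    from elim(2)[folded elim(1)] show ?case by (simp add: zero_ennreal.rep_eq)
  qed
qed

text \<open>Monotone convergence from above. The differences \<open>f 0 - f i\<close> are nonnegative and increase to
  \<open>f 0 - f'\<close>, and \<open>f 0\<close> serves as the integrable majorant of all the functions involved.\<close>

lemma real_cond_exp_tendsto_ereal_cond_exp:
  assumes int: "\<And>i. integrable M (f i)" and f [measurable]: "f' \<in> borel_measurable M"
    and dec: "\<And>x. decseq (\<lambda>i. f i x)" and lim: "\<And>x. (\<lambda>i. f i x) \<longlonglongrightarrow> f' x"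
  shows "AE x in M. (\<lambda>i. ereal (real_cond_exp M F (f i) x)) \<longlonglongrightarrow> ereal_cond_exp M F f' x"
proof -
  have [measurable]: "\<And>i. f i \<in> borel_measurable M" using int by auto
  define N where "N h = nn_cond_exp M F (\<lambda>y. ennreal (f 0 y - h y))" for h
  have mono: "incseq (\<lambda>i y. ennreal (f 0 y - f i y))"
    using dec by (auto simp: incseq_def decseq_def le_fun_def intro!: ennreal_leI)
  have sup: "(SUP i. ennreal (f 0 y - f i y)) = ennreal (f 0 y - f' y)" for y
  proof (rule LIMSEQ_unique)
    show "(\<lambda>i. ennreal (f 0 y - f i y)) \<longlonglongrightarrow> (SUP i. ennreal (f 0 y - f i y))"
      using mono by (intro LIMSEQ_SUP) (auto simp: incseq_def le_fun_def)
    show "(\<lambda>i. ennreal (f 0 y - f i y)) \<longlonglongrightarrow> ennreal (f 0 y - f' y)"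
      using lim by (intro tendsto_intros) auto
  qed
  have "AE x in M. (SUP i. N (f i) x) = N f' x"
    using nn_cond_exp_SUP[OF _ mono] by (simp add: N_def sup)
  moreover have "AE x in M. \<forall>i. N (f i) x \<le> N (f (Suc i)) x"
    unfolding N_def AE_all_countable using mono
    by (auto simp: incseq_Suc_iff le_fun_def intro!: nn_cond_exp_mono)
  moreover have "AE x in M. \<forall>i. ereal_cond_exp M F (f i) x = ereal (real_cond_exp M F (f 0) x) - enn2ereal (N (f i) x)"
    unfolding N_def AE_all_countable using int dec
    by (auto intro!: ereal_cond_exp_eq_diff simp: decseq_def)
  moreover have "AE x in M. \<forall>i. ereal_cond_exp M F (f i) x = ereal (real_cond_exp M F (f i) x)"
    unfolding AE_all_countable using int by (auto intro!: ereal_cond_exp_eq_real_cond_exp)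
  moreover have "f' y \<le> f 0 y" for y
    using decseq_ge[OF dec lim] by auto
  then have "AE x in M. ereal_cond_exp M F f' x = ereal (real_cond_exp M F (f 0) x) - enn2ereal (N f' x)"
    unfolding N_def using int by (intro ereal_cond_exp_eq_diff) auto
  ultimately show ?thesis
  proof eventually_elim
    case (elim x)
    have "(\<lambda>i. N (f i) x) \<longlonglongrightarrow> N f' x"
      using LIMSEQ_SUP[of "\<lambda>i. N (f i) x"] elim(1,2) by (simp add: incseq_Suc_iff)
    then have "(\<lambda>i. ereal (real_cond_exp M F (f 0) x) - enn2ereal (N (f i) x))
        \<longlonglongrightarrow> ereal (real_cond_exp M F (f 0) x) - enn2ereal (N f' x)"
      by (intro tendsto_diff_ereal_general) auto
    moreover have "ereal (real_cond_exp M F (f 0) x) - enn2ereal (N (f i) x)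
        = ereal (real_cond_exp M F (f i) x)" for i
      using elim(3,4) by metis
    ultimately show ?case unfolding elim(5) by simp
  qed
qed

end

section \<open>The geometric mean lies below the power means\<close>

context finite_measure_subalgebra
begin

lemma integrable_exp_mult:
  fixes l :: "'a \<Rightarrow> real"
  assumes l [measurable]: "l \<in> borel_measurable M" and int: "integrable M (\<lambda>x. exp (l x))"
    and s: "0 \<le> s" "s \<le> 1"
  shows "integrable M (\<lambda>x. exp (s * l x))"
proof (rule Bochner_Integration.integrable_bound)
  show "integrable M (\<lambda>x. 1 + exp (l x))" using int by auto
  have "exp (s * t) \<le> 1 + exp t" for t
  proof (cases "t \<ge> 0")
    case True
    then have "s * t \<le> t" using s by (simp add: mult_left_le_one_le)
    then have "exp (s * t) \<le> exp t" by simp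
    then show ?thesis by (simp add: add_increasing)
  next
    case False
    then have "exp (s * t) \<le> 1" using s by (simp add: mult_nonneg_nonpos)
    then show ?thesis by (simp add: add_increasing2)
  qed
  then show "AE x in M. norm (exp (s * l x)) \<le> norm (1 + exp (l x))" by (simp add: add_pos_pos less_imp_le)
qed simp

text \<open>Optimising the tangent inequality over \<open>q\<close> pointwise, after the conditional expectation has been
  taken, avoids conditioning on a product with a random \<open>q\<close>, where integrability could fail.
  Countably many \<open>q\<close> suffice by density.\<close>

lemma exp_cond_exp_le:
  fixes l :: "'a \<Rightarrow> real"
  assumes l [measurable]: "l \<in> borel_measurable M" and int: "integrable M (\<lambda>x. exp (l x))"
    and s: "0 < s" "s \<le> 1"
  shows "AE x in M. exp_ereal (ereal_cond_exp M F l x)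
    \<le> ereal (real_cond_exp M F (\<lambda>y. exp (s * l y)) x powr (1 / s))"
proof -
  have ints: "integrable M (\<lambda>x. exp (s * l x))"
    using integrable_exp_mult[OF l int] s by auto
  let ?Y = "real_cond_exp M F (\<lambda>y. exp (s * l y))"
  \<comment> \<open>The tangent to \<open>ln\<close> at \<open>q\<close>, evaluated at \<open>exp (s * t)\<close>.\<close>
  have tangent: "t \<le> (ln q - 1) / s + exp (s * t) / (q * s)" if "q > 0" for q t
  proof -
    have "s * t - ln q + 1 \<le> exp (s * t - ln q)"
      using exp_ge_add_one_self[of "s * t - ln q"] by linarith
    also have "\<dots> = exp (s * t) / q" using that by (simp add: exp_diff)
    finally have "s * t \<le> ln q - 1 + exp (s * t) / q" by simp
    then have "s * t / s \<le> (ln q - 1 + exp (s * t) / q) / s"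
      using s by (intro divide_right_mono) auto
    then show ?thesis using s by (simp add: add_divide_distrib)
  qed
  have bound: "AE x in M. ereal_cond_exp M F l x \<le> ereal ((ln q - 1) / s + ?Y x / (q * s))"
    if q: "q > 0" for q
  proof -
    have "AE x in M. ereal_cond_exp M F l x
        \<le> ereal (real_cond_exp M F (\<lambda>y. (ln q - 1) / s + exp (s * l y) / (q * s)) x)"
      using ints tangent[OF q] by (intro ereal_cond_exp_le_real_cond_exp) auto
    moreover have "AE x in M. real_cond_exp M F (\<lambda>y. (ln q - 1) / s + exp (s * l y) / (q * s)) x
        = real_cond_exp M F (\<lambda>y. (ln q - 1) / s) x + real_cond_exp M F (\<lambda>y. exp (s * l y) / (q * s)) x"
      using ints by (intro real_cond_exp_add) auto
    moreover have "AE x in M. real_cond_exp M F (\<lambda>y. (ln q - 1) / s) x = (ln q - 1) / s"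
      by (intro real_cond_exp_F_meas) auto
    moreover have "AE x in M. real_cond_exp M F (\<lambda>y. exp (s * l y) / (q * s)) x = ?Y x / (q * s)"
      using ints by (intro real_cond_exp_cdiv)
    ultimately show ?thesis by eventually_elim simp
  qed
  have "AE x in M. \<forall>q\<in>{q\<in>\<rat>. q > 0}. ereal_cond_exp M F l x \<le> ereal ((ln q - 1) / s + ?Y x / (q * s))"
    by (subst AE_ball_countable) (auto intro: bound countable_subset[OF _ countable_rat])
  moreover have "AE x in M. ?Y x > 0"
    using ints by (intro real_cond_exp_gr_c) auto
  ultimately show ?thesis
  proof eventually_elim
    case (elim x)
    have "ereal_cond_exp M F l x \<le> ereal (ln (?Y x) / s + e)" if e: "e > 0" for e
    proof -
      \<comment> \<open>The bound is optimal at \<open>q = ?Y x\<close>; a rational \<open>q\<close> in this interval costs at most \<open>e\<close>.\<close>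
      have "?Y x < ?Y x * exp (e * s)" using elim e s by simp
      then obtain q where q: "q \<in> \<rat>" "?Y x < q" "q < ?Y x * exp (e * s)"
        using Rats_dense_in_real by blast
      have "q > 0" using q elim by simp
      have "ln q < ln (?Y x * exp (e * s))" using q \<open>q > 0\<close> by (subst ln_less_cancel_iff) auto
      also have "\<dots> = ln (?Y x) + e * s" using elim by (simp add: ln_mult)
      finally have "ln q < ln (?Y x) + e * s" .
      moreover have "?Y x / q \<le> 1" using q \<open>q > 0\<close> by simp
      ultimately have "ln q - 1 + ?Y x / q \<le> ln (?Y x) + e * s" by linarith
      then have "(ln q - 1 + ?Y x / q) / s \<le> (ln (?Y x) + e * s) / s"
        using s by (intro divide_right_mono) auto
      then have "(ln q - 1) / s + ?Y x / (q * s) \<le> ln (?Y x) / s + e"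
        using s by (simp add: add_divide_distrib)
      then have "ereal ((ln q - 1) / s + ?Y x / (q * s)) \<le> ereal (ln (?Y x) / s + e)" by simp
      moreover have "ereal_cond_exp M F l x \<le> ereal ((ln q - 1) / s + ?Y x / (q * s))"
        using elim(1) q(1) \<open>q > 0\<close> by blast
      ultimately show ?thesis by (rule order_trans[rotated])
    qed
    then have "ereal_cond_exp M F l x \<le> ereal (ln (?Y x) / s)"
      unfolding plus_ereal.simps(1)[symmetric] by (rule ereal_le_epsilon2)
    from exp_ereal_mono[OF this] have "exp_ereal (ereal_cond_exp M F l x) \<le> ereal (exp (ln (?Y x) / s))"
      by (simp add: exp_ereal_def)
    also have "exp (ln (?Y x) / s) = ?Y x powr (1 / s)" using elim(2) by (simp add: powr_def)
    finally show ?case .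
  qed
qed

end

section \<open>The geometric mean is the limit of the power means\<close>

text \<open>Halving the exponent replaces \<open>r\<^sup>2 - 1\<close> by \<open>2 (r - 1)\<close>, which is smaller because
  \<open>(r - 1)\<^sup>2 \<ge> 0\<close>.\<close>

lemma decseq_dyadic_exp_quotient:
  fixes t :: real
  shows "decseq (\<lambda>i. 2 ^ i * (exp (t / 2 ^ i) - 1))"
proof (rule decseq_SucI)
  fix i
  define r where "r = exp (t / 2 ^ Suc i)"
  have "exp (t / 2 ^ i) = r\<^sup>2" by (simp add: r_def flip: exp_double)
  moreover have "2 * (r - 1) \<le> r\<^sup>2 - 1" using zero_le_power2[of "r - 1"] by (simp add: power2_diff)
  ultimately have "2 * (r - 1) \<le> exp (t / 2 ^ i) - 1" by simp
  then have "2 ^ i * (2 * (r - 1)) \<le> 2 ^ i * (exp (t / 2 ^ i) - 1)"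
    by (intro mult_left_mono) auto
  then show "2 ^ Suc i * (exp (t / 2 ^ Suc i) - 1) \<le> 2 ^ i * (exp (t / 2 ^ i) - 1)"
    by (simp add: r_def mult_ac)
qed

lemma tendsto_dyadic_exp_quotient:
  fixes t :: real
  shows "(\<lambda>i. 2 ^ i * (exp (t / 2 ^ i) - 1)) \<longlonglongrightarrow> t"
proof -
  have "((\<lambda>h. exp (t * h)) has_real_derivative t) (at 0)"
    by (auto intro!: derivative_eq_intros)
  then have "((\<lambda>h. (exp (t * h) - 1) / h) \<longlongrightarrow> t) (at 0)"
    by (simp add: DERIV_def)
  moreover have "filterlim (\<lambda>i. (1 / 2) ^ i :: real) (at 0) sequentially"
    by (auto simp: filterlim_at LIMSEQ_power_zero)
  ultimately have "(\<lambda>i. (exp (t * (1 / 2) ^ i) - 1) / (1 / 2) ^ i) \<longlonglongrightarrow> t"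
    by (rule filterlim_compose)
  then show ?thesis by (simp add: field_simps power_one_over)
qed

text \<open>With \<open>Y = E(exp (s l) | F)\<close>, the hypothesis for \<open>s\<close> gives
  \<open>ln (E(exp l | F) / C) \<le> ln Y / s \<le> (Y - 1) / s\<close>, and the right-hand side is the conditional
  expectation of \<open>(exp (s l) - 1) / s\<close>. Its limit along \<open>s = 1/2^i\<close> is \<open>E(l | F)\<close>, which is
  thereby also seen to be different from \<open>-\<infinity>\<close>.\<close>

lemma (in finite_measure_subalgebra) le_exp_cond_exp:
  fixes l :: "'a \<Rightarrow> real"
  assumes l [measurable]: "l \<in> borel_measurable M" and int: "integrable M (\<lambda>x. exp (l x))"
    and C: "C > 0"
    and le: "\<And>s. 0 < s \<Longrightarrow> s < 1 \<Longrightarrow> AE x in M. real_cond_exp M F (\<lambda>y. exp (l y)) x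
      \<le> C * real_cond_exp M F (\<lambda>y. exp (s * l y)) x powr (1 / s)"
  shows "AE x in M. ereal (real_cond_exp M F (\<lambda>y. exp (l y)) x)
    \<le> ereal C * exp_ereal (ereal_cond_exp M F l x)"
proof -
  let ?a = "real_cond_exp M F (\<lambda>y. exp (l y))"
  define s :: "nat \<Rightarrow> real" where "s i = 1 / 2 ^ i" for i
  define Y where "Y i = real_cond_exp M F (\<lambda>y. exp (s i * l y))" for i
  define f where "f i y = 2 ^ i * (exp (s i * l y) - 1)" for i y
  have s: "0 < s i" "s i \<le> 1" for i by (auto simp: s_def)
  have ints: "integrable M (\<lambda>y. exp (s i * l y))" for i
    using integrable_exp_mult[OF l int] s[of i] by simp
  have Y: "AE x in M. real_cond_exp M F (f i) x = 2 ^ i * (Y i x - 1)" for i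
  proof -
    have "AE x in M. real_cond_exp M F (f i) x = 2 ^ i * real_cond_exp M F (\<lambda>y. exp (s i * l y) - 1) x"
      unfolding f_def using ints by (intro real_cond_exp_cmult) auto
    moreover have "AE x in M. real_cond_exp M F (\<lambda>y. exp (s i * l y) - 1) x
        = Y i x - real_cond_exp M F (\<lambda>y. 1) x"
      unfolding Y_def using ints by (intro real_cond_exp_diff) auto
    moreover have "AE x in M. real_cond_exp M F (\<lambda>y. 1) x = 1"
      by (intro real_cond_exp_F_meas) auto
    ultimately show ?thesis by eventually_elim simp
  qed
  have "AE x in M. (\<lambda>i. ereal (real_cond_exp M F (f i) x)) \<longlonglongrightarrow> ereal_cond_exp M F l x"
    using ints decseq_dyadic_exp_quotient tendsto_dyadic_exp_quotient
    by (intro real_cond_exp_tendsto_ereal_cond_exp) (auto simp: f_def[abs_def] s_def)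
  moreover have "AE x in M. \<forall>i. real_cond_exp M F (f i) x = 2 ^ i * (Y i x - 1)"
    unfolding AE_all_countable using Y by blast
  moreover have "AE x in M. \<forall>i. Y i x > 0"
    unfolding AE_all_countable Y_def using ints by (auto intro!: real_cond_exp_gr_c)
  \<comment> \<open>The index is shifted because \<open>s 0 = 1\<close>, while the hypothesis requires \<open>s < 1\<close>.\<close>
  moreover have "AE x in M. \<forall>i. ?a x \<le> C * Y (Suc i) x powr 2 ^ Suc i"
  proof -
    have "AE x in M. ?a x \<le> C * Y (Suc i) x powr 2 ^ Suc i" for i
    proof -
      have "s (Suc i) < 1"
        using one_less_power[of "2 :: real" "Suc i"] by (simp add: s_def)
      from le[OF s(1) this] show ?thesis by (simp add: s_def Y_def)
    qed
    then show ?thesis unfolding AE_all_countable by blast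
  qed
  moreover have "AE x in M. ?a x > 0"
    using int by (intro real_cond_exp_gr_c) auto
  ultimately show ?thesis
  proof eventually_elim
    case (elim x)
    have "ereal (ln (?a x / C)) \<le> ereal (real_cond_exp M F (f (Suc i)) x)" for i
    proof -
      have Ypos: "Y (Suc i) x > 0" using elim by blast
      have "?a x / C \<le> Y (Suc i) x powr 2 ^ Suc i"
        using elim C by (simp add: field_simps)
      moreover have "0 < ?a x / C" using elim(5) C by simp
      ultimately have "ln (?a x / C) \<le> ln (Y (Suc i) x powr 2 ^ Suc i)"
        by (rule ln_mono)
      also have "\<dots> = 2 ^ Suc i * ln (Y (Suc i) x)" using Ypos by (simp add: ln_powr)
      also have "\<dots> \<le> 2 ^ Suc i * (Y (Suc i) x - 1)"
        using ln_le_minus_one[OF Ypos] by (intro mult_left_mono) auto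
      finally show ?thesis using elim by simp
    qed
    then have "ereal (ln (?a x / C)) \<le> ereal_cond_exp M F l x"
      by (intro LIMSEQ_le_const[OF LIMSEQ_Suc[OF elim(1)]] exI[of _ 0] allI impI)
    from exp_ereal_mono[OF this]
    have "ereal (?a x / C) \<le> exp_ereal (ereal_cond_exp M F l x)"
      using elim C by (simp add: exp_ereal_def)
    then have "ereal C * ereal (?a x / C) \<le> ereal C * exp_ereal (ereal_cond_exp M F l x)"
      using C by (intro ereal_mult_left_mono) auto
    then show ?case using C by simp
  qed
qed

section \<open>Equivalence of the two conditions\<close>

theorem theorem1p5:
  fixes M :: "'a measure" and F :: "nat \<Rightarrow> 'a measure" and w :: "'a \<Rightarrow> real"
  assumes "prob_space M" and "complete_measure M"
    and "filtration (space M) F"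
    and "\<And>n. subalgebra M (F n)"
    and "sets M = sigma_sets (space M) (\<Union>n. sets (F n))"
    and "weight M w"
  shows "A_inf_exp M F w \<longleftrightarrow> A_inf_SW M F w"
proof -
  have fms: "finite_measure_subalgebra M (F n)" for n
    using assms(1) assms(4)[of n]
    by (simp add: finite_measure_subalgebra_def finite_measure_subalgebra_axioms_def prob_space_def)
  have sfs: "sigma_finite_subalgebra M (F n)" for n
    using fms by (rule finite_measure_subalgebra_is_sigma_finite)
  have [measurable]: "w \<in> borel_measurable M" and pos: "AE x in M. 0 < w x" and int: "integrable M w"
    using assms(6) by (auto simp: weight_def)
  define l where "l x = ln (w x)" for x
  have l [measurable]: "l \<in> borel_measurable M" unfolding l_def by measurable
  have w_eq: "AE x in M. w x = exp (l x)" using pos by eventually_elim (simp add: l_def)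
  have powr_eq: "AE x in M. w x powr s = exp (s * l x)" for s
    using pos by eventually_elim (simp add: l_def powr_def)
  have int_exp: "integrable M (\<lambda>x. exp (l x))"
    using int w_eq by (subst integrable_cong_AE[of _ _ w]) (auto elim: eventually_mono)
  have E_w: "AE x in M. real_cond_exp M (F n) w x = real_cond_exp M (F n) (\<lambda>y. exp (l y)) x" for n
    using w_eq by (intro sigma_finite_subalgebra.real_cond_exp_cong[OF sfs]) auto
  have E_powr: "AE x in M. real_cond_exp M (F n) (\<lambda>y. w y powr s) x
      = real_cond_exp M (F n) (\<lambda>y. exp (s * l y)) x" for n s
    using powr_eq by (intro sigma_finite_subalgebra.real_cond_exp_cong[OF sfs]) auto
  show ?thesis
  proof
    assume "A_inf_exp M F w"
    then obtain C where C: "C > 0" and le: "\<And>n. AE x in M. ereal (real_cond_exp M (F n) w x)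
        \<le> ereal C * exp_ereal (ereal_cond_exp M (F n) l x)"
      by (auto simp: A_inf_exp_def l_def[abs_def])
    \<comment> \<open>The constant is enlarged because the power-mean condition asks for one above \<open>1\<close>.\<close>
    have "AE x in M. real_cond_exp M (F n) w x
        \<le> (C + 1) * real_cond_exp M (F n) (\<lambda>y. w y powr s) x powr (1 / s)"
      if s: "0 < s" "s < 1" for s n
      using le[of n] E_powr[of n s]
        finite_measure_subalgebra.exp_cond_exp_le[OF fms l int_exp s(1) less_imp_le[OF s(2)], of n]
    proof eventually_elim
      case (elim x)
      let ?Y = "real_cond_exp M (F n) (\<lambda>y. w y powr s) x powr (1 / s)"
      have "exp_ereal (ereal_cond_exp M (F n) l x) \<le> ereal ?Y" using elim by simp
      then have "ereal C * exp_ereal (ereal_cond_exp M (F n) l x) \<le> ereal C * ereal ?Y"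
        using C by (intro ereal_mult_left_mono) auto
      with elim(1) have "ereal (real_cond_exp M (F n) w x) \<le> ereal C * ereal ?Y" by (rule order_trans)
      then have "real_cond_exp M (F n) w x \<le> C * ?Y" by simp
      also have "\<dots> \<le> (C + 1) * ?Y" by (intro mult_right_mono) auto
      finally show ?case .
    qed
    then show "A_inf_SW M F w"
      unfolding A_inf_SW_def using C by (intro exI[of _ "C + 1"]) auto
  next
    assume "A_inf_SW M F w"
    then obtain C where C: "C > 1" and le: "\<And>s n. 0 < s \<Longrightarrow> s < 1 \<Longrightarrow>
        AE x in M. real_cond_exp M (F n) w x
          \<le> C * real_cond_exp M (F n) (\<lambda>y. w y powr s) x powr (1 / s)"
      by (auto simp: A_inf_SW_def)
    have "AE x in M. ereal (real_cond_exp M (F n) w x)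
        \<le> ereal C * exp_ereal (ereal_cond_exp M (F n) l x)" for n
    proof -
      have "AE x in M. real_cond_exp M (F n) (\<lambda>y. exp (l y)) x
          \<le> C * real_cond_exp M (F n) (\<lambda>y. exp (s * l y)) x powr (1 / s)"
        if "0 < s" "s < 1" for s
        using le[OF that, of n] E_w[of n] E_powr[of n s] by eventually_elim simp
      then have "AE x in M. ereal (real_cond_exp M (F n) (\<lambda>y. exp (l y)) x)
          \<le> ereal C * exp_ereal (ereal_cond_exp M (F n) l x)"
        using C by (intro finite_measure_subalgebra.le_exp_cond_exp[OF fms l int_exp]) auto
      with E_w[of n] show ?thesis by eventually_elim simp
    qed
    then show "A_inf_exp M F w"
      unfolding A_inf_exp_def using C by (intro exI[of _ C]) (auto simp: l_def[abs_def])
  qed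
qed

end
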